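(* Let $n\ge 1$, and let $C_0,C_1,C_2>0$ be constants. There exists a constant $C>0$, depending only on $C_0,C_1,C_2$, such that the following holds. Let $\epsilon_{\text{machine}}>0$, let $A$ be a nonsingular $n\times n$ (real or complex) matrix with $\kappa(A)\,\epsilon_{\text{machine}}\le C_0$, let $b\neq 0$ be a vector, and let $x=A^{-1}b$ be the exact solution of $Ax=b$. Let $V$ be an $n\times n$ matrix (an approximate inverse of $A$) satisfying $\|VA-I\|\le C_1\,\kappa(A)\,\epsilon_{\text{machine}}$. Let $x_V$ be the floating-point product of $V$ and $b$, i.e. $x_V=(V+\Delta)b$ for some matrix $\Delta$ with $\|\Delta\|\le C_2\,\epsilon_{\text{machine}}\,\|V\|$. Then \[ \frac{\|x_V-x\|}{\|x\|}\le C\,\kappa(A)\,\epsilon_{\text{machine}} . \]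
   Context: $\|\cdot\|$ denotes a vector norm on $n$-vectors and the matrix norm it induces; $\kappa(A)=\|A\|\,\|A^{-1}\|$ is the condition number of $A$; $\epsilon_{\text{machine}}$ is the unit of relative rounding error, treated as a positive parameter. Floating-point matrix-vector multiplication is modelled by the standard backward error statement: the computed product of $V$ and $b$ equals $(V+\Delta)b$ exactly for some perturbation $\Delta$ with $\|\Delta\|/\|V\|=O(\epsilon_{\text{machine}})$. The constant $C_2$ may in practice depend on the dimension $n$. *)

theory Defs
  imports Complex_Main "Jordan_Normal_Form.Gauss_Jordan_Elimination"
begin

definition is_vector_norm :: "nat \<Rightarrow> ('a::real_normed_field vec \<Rightarrow> real) \<Rightarrow> bool" where
  "is_vector_norm n N \<longleftrightarrow>
     (\<forall>x \<in> carrier_vec n. N x \<ge> 0) \<and>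
     (\<forall>x \<in> carrier_vec n. N x = 0 \<longleftrightarrow> x = 0\<^sub>v n) \<and>
     (\<forall>c. \<forall>x \<in> carrier_vec n. N (c \<cdot>\<^sub>v x) = norm c * N x) \<and>
     (\<forall>x \<in> carrier_vec n. \<forall>y \<in> carrier_vec n. N (x + y) \<le> N x + N y)"

text \<open>The operator norm is meant for square matrices of positive dimension: then the set below
  is nonempty, and it is bounded above because all norms on a finite-dimensional space over
  \<open>\<real>\<close> or \<open>\<complex>\<close> are equivalent, so that \<^const>\<open>Sup\<close> is a genuine supremum.\<close>

definition induced_norm :: "('a::real_normed_field vec \<Rightarrow> real) \<Rightarrow> 'a mat \<Rightarrow> real" where
  "induced_norm N A =
     Sup {N (A *\<^sub>v x) / N x | x. x \<in> carrier_vec (dim_col A) \<and> x \<noteq> 0\<^sub>v (dim_col A)}"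

text \<open>Unspecified for singular matrices, where \<^const>\<open>mat_inverse\<close> returns \<^const>\<open>None\<close>.\<close>

definition inverse_mat :: "'a::field mat \<Rightarrow> 'a mat" where
  "inverse_mat A = the (mat_inverse A)"

definition cond_number :: "('a::real_normed_field vec \<Rightarrow> real) \<Rightarrow> 'a mat \<Rightarrow> real" where
  "cond_number N A = induced_norm N A * induced_norm N (inverse_mat A)"

text \<open>Backward error model of a floating-point matrix-vector product: \<open>y\<close> is an admissible
  computed value of \<open>V *\<^sub>v b\<close>, with unit roundoff \<open>\<epsilon>\<close> and implied constant \<open>K\<close>.\<close>

definition fl_mult_mat_vec ::
  "('a::real_normed_field vec \<Rightarrow> real) \<Rightarrow> real \<Rightarrow> real \<Rightarrow> 'a mat \<Rightarrow> 'a vec \<Rightarrow> 'a vec \<Rightarrow> bool" where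
  "fl_mult_mat_vec N K \<epsilon> V b y \<longleftrightarrow>
     (\<exists>\<Delta> \<in> carrier_mat (dim_row V) (dim_col V).
        induced_norm N \<Delta> \<le> K * \<epsilon> * induced_norm N V \<and> y = (V + \<Delta>) *\<^sub>v b)"

end

(* Put E = VA - I. Since b = A x, the error is x_V - x = E x + Delta A x, so its norm is at most
   (norm E + norm Delta * norm A) * norm x. Moreover V = (I + E) A^-1, hence
   norm V <= (1 + C1 kappa eps) norm A^-1 <= (1 + C1 C0) norm A^-1, and C = C1 + C2 (1 + C0 C1) works.
   That the supremum in the induced norm is a genuine bound rests on the equivalence of
   all norms on a finite-dimensional space, obtained by compactness from Tychonoff's theorem. *)
theory Submission
  imports Defs "HOL-Analysis.Function_Topology" "HOL-Analysis.Topology_Euclidean_Space"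
begin

section \<open>Elementary properties and continuity of a vector norm\<close>

locale vector_norm =
  fixes n :: nat and N :: "'a::real_normed_field Matrix.vec \<Rightarrow> real"
  assumes norm: "is_vector_norm n N"
begin

lemma nonneg [simp]: "x \<in> carrier_vec n \<Longrightarrow> 0 \<le> N x"
  and eq_0_iff: "x \<in> carrier_vec n \<Longrightarrow> N x = 0 \<longleftrightarrow> x = 0\<^sub>v n"
  and scale: "x \<in> carrier_vec n \<Longrightarrow> N (c \<cdot>\<^sub>v x) = norm c * N x"
  and triangle: "x \<in> carrier_vec n \<Longrightarrow> y \<in> carrier_vec n \<Longrightarrow> N (x + y) \<le> N x + N y"
  using norm unfolding is_vector_norm_def by blast+

lemma zero [simp]: "N (0\<^sub>v n) = 0"
  by (simp add: eq_0_iff)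

lemma pos: "x \<in> carrier_vec n \<Longrightarrow> x \<noteq> 0\<^sub>v n \<Longrightarrow> 0 < N x"
  using nonneg[of x] eq_0_iff[of x] by linarith

text \<open>Expansion in the standard basis, followed by the triangle inequality and homogeneity.
  This is the easy half of norm equivalence; it yields both the continuity of \<open>N\<close> and
  the boundedness of matrices.\<close>

lemma le_sum_unit_vec:
  assumes x: "x \<in> carrier_vec n"
  shows "N x \<le> (\<Sum>i<n. norm (x $ i) * N (unit_vec n i))"
proof -
  \<comment> \<open>The induction runs over truncations of \<open>x\<close> to its first
    \<open>k\<close> coordinates, all kept in dimension \<open>n\<close>, so that each step adds one
    multiple of a unit vector.\<close>
  have partial: "N (Matrix.vec n (\<lambda>i. if i < k then x $ i else 0)) \<le> (\<Sum>i<k. norm (x $ i) * N (unit_vec n i))"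
    if "k \<le> n" for k
    using that
  proof (induction k)
    case 0
    have "Matrix.vec n (\<lambda>i. if i < 0 then x $ i else 0) = 0\<^sub>v n" by auto
    then show ?case by simp
  next
    case (Suc k)
    have "Matrix.vec n (\<lambda>i. if i < Suc k then x $ i else 0) =
      Matrix.vec n (\<lambda>i. if i < k then x $ i else 0) + x $ k \<cdot>\<^sub>v unit_vec n k"
      using Suc.prems by (auto simp: less_Suc_eq)
    then have "N (Matrix.vec n (\<lambda>i. if i < Suc k then x $ i else 0)) \<le>
      N (Matrix.vec n (\<lambda>i. if i < k then x $ i else 0)) + N (x $ k \<cdot>\<^sub>v unit_vec n k)"
      using triangle by simp
    also have "N (x $ k \<cdot>\<^sub>v unit_vec n k) = norm (x $ k) * N (unit_vec n k)"
      by (simp add: scale)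
    finally show ?case using Suc by simp
  qed
  have "Matrix.vec n (\<lambda>i. if i < n then x $ i else 0) = x"
    using x by auto
  then show ?thesis using partial[of n] by simp
qed

lemma diff_commute:
  assumes "x \<in> carrier_vec n" "y \<in> carrier_vec n"
  shows "N (x - y) = N (y - x)"
proof -
  have "x - y = (- 1) \<cdot>\<^sub>v (y - x)" using assms by auto
  then show ?thesis using scale[of "y - x" "- 1"] assms by simp
qed

lemma abs_diff_le:
  assumes "x \<in> carrier_vec n" "y \<in> carrier_vec n"
  shows "\<bar>N x - N y\<bar> \<le> N (x - y)"
proof -
  have "N x \<le> N (x - y) + N y" if "x \<in> carrier_vec n" "y \<in> carrier_vec n" for x y
  proof -
    have "x = (x - y) + y" using that by auto
    then show ?thesis using triangle[of "x - y" y] that by simp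
  qed
  from this[of x y] this[of y x] show ?thesis
    using diff_commute[of x y] assms by auto
qed

text \<open>Functions on \<open>nat\<close> with the product topology stand in for vectors, so that
  compactness of products applies. By the reverse triangle inequality the change in \<open>N\<close>
  is at most a weighted sum of coordinate changes, which tends to 0 under coordinatewise
  convergence.\<close>

lemma continuous_on_vec: "continuous_on S (\<lambda>f. N (Matrix.vec n f))"
  unfolding continuous_on_def
proof
  fix g
  \<comment> \<open>Here \<open>g\<close> is arbitrary and may lie outside \<open>S\<close>;
    continuity on \<open>insert g S\<close> gives the limit at \<open>g\<close>, which is then
    restricted to \<open>S\<close>.\<close>
  have coord: "((\<lambda>f. f i) \<longlongrightarrow> g i) (at g within S)" for i
    using continuous_on_subset[OF continuous_on_product_coordinates, of "insert g S" i]
    by (auto simp: continuous_on_def intro: tendsto_within_subset)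
  have "((\<lambda>f. \<Sum>i<n. norm (f i - g i) * N (unit_vec n i)) \<longlongrightarrow>
      (\<Sum>i<n. norm (g i - g i) * N (unit_vec n i))) (at g within S)"
    by (intro tendsto_intros coord)
  then have lim: "((\<lambda>f. \<Sum>i<n. norm (f i - g i) * N (unit_vec n i)) \<longlongrightarrow> 0) (at g within S)"
    by simp
  have "norm (N (Matrix.vec n f) - N (Matrix.vec n g)) \<le> (\<Sum>i<n. norm (f i - g i) * N (unit_vec n i))"
    for f
  proof -
    have "norm (N (Matrix.vec n f) - N (Matrix.vec n g)) \<le> N (Matrix.vec n f - Matrix.vec n g)"
      using abs_diff_le by simp
    also have "\<dots> \<le> (\<Sum>i<n. norm ((Matrix.vec n f - Matrix.vec n g) $ i) * N (unit_vec n i))"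
      by (rule le_sum_unit_vec) simp
    finally show ?thesis by simp
  qed
  then have "((\<lambda>f. N (Matrix.vec n f) - N (Matrix.vec n g)) \<longlongrightarrow> 0) (at g within S)"
    by (intro Lim_null_comparison[OF _ lim]) simp
  then show "((\<lambda>f. N (Matrix.vec n f)) \<longlongrightarrow> N (Matrix.vec n g)) (at g within S)"
    by (simp add: LIM_zero_iff)
qed

end

section \<open>Norm equivalence by compactness\<close>

lemma compact_PiE_UNIV:
  fixes S :: "'i \<Rightarrow> 'b::topological_space set"
  assumes "\<And>i. compact (S i)"
  shows "compact (PiE UNIV S)"
proof -
  have "compactin (product_topology (\<lambda>i. euclidean) UNIV) (PiE UNIV S)"
    using assms by (simp add: compactin_PiE)
  then show ?thesis by (simp add: euclidean_product_topology)
qed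

text \<open>The class \<open>heine_borel\<close> makes the unit sphere and closed unit ball of the
  scalar field compact, and it covers the reals and the complex numbers alike.\<close>

locale vector_norm_heine_borel = vector_norm n N
  for n :: nat and N :: "'a::{real_normed_field, heine_borel} Matrix.vec \<Rightarrow> real"
begin

text \<open>A face of the unit ball of the maximum norm is compact, so \<open>N\<close> attains a
  minimum there; the minimum is positive because coordinate \<open>j\<close> of the minimiser is
  nonzero.\<close>

lemma lower_bound_on_face:
  assumes "j < n"
  obtains c where "c > 0"
    "\<And>x. x \<in> carrier_vec n \<Longrightarrow> norm (x $ j) = 1 \<Longrightarrow> (\<And>i. i < n \<Longrightarrow> norm (x $ i) \<le> 1) \<Longrightarrow> c \<le> N x"
proof -
  \<comment> \<open>Coordinates from \<open>n\<close> on also range over the closed ball: this keeps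
    the product compact, and \<open>Matrix.vec n\<close> discards them.\<close>
  define K :: "(nat \<Rightarrow> 'a) set" where "K = PiE UNIV (\<lambda>i. if i = j then sphere 0 1 else cball 0 1)"
  have "compact K"
    unfolding K_def by (rule compact_PiE_UNIV) auto
  moreover have "(\<lambda>i. 1) \<in> K"
    by (auto simp: K_def)
  ultimately obtain f where f: "f \<in> K" "\<And>g. g \<in> K \<Longrightarrow> N (Matrix.vec n f) \<le> N (Matrix.vec n g)"
    using continuous_attains_inf[OF _ _ continuous_on_vec, of K] by blast
  have fj: "norm (f j) = 1"
    using f(1) by (auto simp: K_def PiE_iff dest: spec[of _ j])
  show thesis
  proof
    have "Matrix.vec n f $ j \<noteq> 0\<^sub>v n $ j"
      using fj assms by auto
    then have "Matrix.vec n f \<noteq> 0\<^sub>v n" by metis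
    then show "0 < N (Matrix.vec n f)"
      by (simp add: pos)
    fix x :: "'a Matrix.vec"
    assume x: "x \<in> carrier_vec n" "norm (x $ j) = 1" "\<And>i. i < n \<Longrightarrow> norm (x $ i) \<le> 1"
    \<comment> \<open>Entries of \<open>x\<close> beyond its dimension are not controlled, so they
      are replaced by 0 to land in \<open>K\<close>.\<close>
    have "(\<lambda>i. if i < n then x $ i else 0) \<in> K"
      using x assms by (auto simp: K_def PiE_iff)
    moreover have "Matrix.vec n (\<lambda>i. if i < n then x $ i else 0) = x"
      using x(1) by auto
    ultimately show "N (Matrix.vec n f) \<le> N x"
      using f(2) by metis
  qed
qed

text \<open>The hard half of norm equivalence. Dividing a nonzero vector by its entry of largest
  modulus moves it onto one of finitely many faces, and homogeneity carries the bound back.\<close>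

lemma lower_bound:
  obtains c where "c > 0" "\<And>x i. x \<in> carrier_vec n \<Longrightarrow> i < n \<Longrightarrow> c * norm (x $ i) \<le> N x"
proof -
  have "\<exists>c>0. \<forall>x\<in>carrier_vec n. norm (x $ j) = 1 \<longrightarrow> (\<forall>i<n. norm (x $ i) \<le> 1) \<longrightarrow> c \<le> N x"
    if "j < n" for j
    using lower_bound_on_face[OF that] by metis
  then obtain c where c: "\<And>j. j < n \<Longrightarrow> c j > 0"
    "\<And>j x. j < n \<Longrightarrow> x \<in> carrier_vec n \<Longrightarrow> norm (x $ j) = 1 \<Longrightarrow> \<forall>i<n. norm (x $ i) \<le> 1 \<Longrightarrow> c j \<le> N x"
    by metis
  \<comment> \<open>Inserting 1 keeps the set nonempty when \<open>n = 0\<close>.\<close>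
  define d where "d = Min (insert 1 (c ` {..<n}))"
  have d: "d > 0" "\<And>j. j < n \<Longrightarrow> d \<le> c j"
    using c(1) by (auto simp: d_def)
  show thesis
  proof
    show "d > 0" by fact
    fix x :: "'a Matrix.vec" and i
    assume x: "x \<in> carrier_vec n" and i: "i < n"
    have "Max ((\<lambda>k. norm (x $ k)) ` {..<n}) \<in> (\<lambda>k. norm (x $ k)) ` {..<n}"
      using i by (intro Max_in) auto
    then obtain j where j: "j < n" "Max ((\<lambda>k. norm (x $ k)) ` {..<n}) = norm (x $ j)"
      by auto
    have le: "norm (x $ k) \<le> norm (x $ j)" if "k < n" for k
      using that by (simp flip: j(2))
    show "d * norm (x $ i) \<le> N x"
    proof (cases "x $ j = 0")
      case True
      then show ?thesis using le[OF i] x by simp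
    next
      case False
      define y where "y = inverse (x $ j) \<cdot>\<^sub>v x"
      have "\<forall>k<n. norm (y $ k) \<le> 1"
        using le x False by (auto simp: y_def norm_mult norm_inverse norm_divide divide_le_eq field_simps)
      moreover have "norm (y $ j) = 1"
        using x j(1) False by (simp add: y_def)
      moreover have "y \<in> carrier_vec n"
        using x by (simp add: y_def)
      ultimately have "d \<le> N y"
        using c(2) d(2) j(1) by (meson order_trans)
      also have "N y = N x / norm (x $ j)"
        using x by (simp add: y_def scale norm_inverse divide_inverse mult.commute)
      finally have "d * norm (x $ j) \<le> N x"
        using False by (simp add: field_simps)
      moreover have "d * norm (x $ i) \<le> d * norm (x $ j)"
        using le[OF i] d(1) by simp
      ultimately show ?thesis by linarith
    qed
  qed
qed

section \<open>Boundedness of matrices and the induced norm\<close>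

lemma mult_mat_vec_bounded:
  assumes M: "M \<in> carrier_mat n n"
  obtains B where "\<And>x. x \<in> carrier_vec n \<Longrightarrow> N (M *\<^sub>v x) \<le> B * N x"
proof -
  obtain c where c: "c > 0" "\<And>x i. x \<in> carrier_vec n \<Longrightarrow> i < n \<Longrightarrow> c * norm (x $ i) \<le> N x"
    using lower_bound by blast
  show thesis
  proof
    fix x :: "'a Matrix.vec"
    assume x: "x \<in> carrier_vec n"
    \<comment> \<open>The lower bound turns each entry of \<open>x\<close> into at most
      \<open>N x / c\<close>.\<close>
    have entry: "norm ((M *\<^sub>v x) $ i) \<le> (\<Sum>j<n. norm (M $$ (i, j)) * (N x / c))" if "i < n" for i
    proof -
      have "norm ((M *\<^sub>v x) $ i) \<le> (\<Sum>j<n. norm (M $$ (i, j) * x $ j))"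
        using M x that
        by (auto simp: scalar_prod_def lessThan_atLeast0 intro!: sum_norm_le)
      also have "\<dots> \<le> (\<Sum>j<n. norm (M $$ (i, j)) * (N x / c))"
        unfolding norm_mult using c x
        by (intro sum_mono mult_left_mono) (auto simp: le_divide_eq mult.commute)
      finally show ?thesis .
    qed
    have "N (M *\<^sub>v x) \<le> (\<Sum>i<n. norm ((M *\<^sub>v x) $ i) * N (unit_vec n i))"
      using M x by (intro le_sum_unit_vec) auto
    also have "\<dots> \<le> (\<Sum>i<n. (\<Sum>j<n. norm (M $$ (i, j)) * (N x / c)) * N (unit_vec n i))"
      using entry by (intro sum_mono mult_right_mono) auto
    \<comment> \<open>The coefficient of \<open>N x\<close> is now independent of \<open>x\<close>
      and serves as the bound \<open>B\<close>.\<close>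
    also have "\<dots> = (\<Sum>i<n. (\<Sum>j<n. norm (M $$ (i, j))) / c * N (unit_vec n i)) * N x"
      by (simp add: sum_distrib_left sum_distrib_right sum_divide_distrib ac_simps)
    finally show "N (M *\<^sub>v x) \<le> \<dots>" .
  qed
qed

text \<open>Boundedness of \<open>M\<close> makes the set of quotients bounded above, so each
  quotient lies below the supremum. The zero vector is absent from that set and is treated
  apart.\<close>

lemma mult_mat_vec_le:
  assumes M: "M \<in> carrier_mat n n" and x: "x \<in> carrier_vec n"
  shows "N (M *\<^sub>v x) \<le> induced_norm N M * N x"
proof (cases "x = 0\<^sub>v n")
  case True
  then have "M *\<^sub>v x = 0\<^sub>v n" using M by auto
  then show ?thesis using True by simp
next
  case False
  obtain B where B: "\<And>x. x \<in> carrier_vec n \<Longrightarrow> N (M *\<^sub>v x) \<le> B * N x"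
    using mult_mat_vec_bounded[OF M] by blast
  have "N (M *\<^sub>v x) / N x \<le> induced_norm N M"
    unfolding induced_norm_def
  proof (rule cSup_upper)
    show "bdd_above {N (M *\<^sub>v x) / N x |x. x \<in> carrier_vec (dim_col M) \<and> x \<noteq> 0\<^sub>v (dim_col M)}"
      using B M pos by (intro bdd_aboveI[of _ B]) (auto simp: divide_le_eq)
  qed (use M x False in auto)
  then show ?thesis using pos[OF x False] by (simp add: divide_le_eq)
qed

lemma induced_norm_nonneg:
  assumes "M \<in> carrier_mat n n" "n \<ge> 1"
  shows "0 \<le> induced_norm N M"
proof -
  have "unit_vec n 0 \<noteq> (0\<^sub>v n :: 'a Matrix.vec)"
    using assms(2) by (simp add: unit_vec_nonzero)
  then have "0 < N (unit_vec n 0)" by (simp add: pos)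
  moreover have "0 \<le> induced_norm N M * N (unit_vec n 0)"
    using assms(1) by (intro order_trans[OF nonneg mult_mat_vec_le]) auto
  ultimately show ?thesis by (simp add: zero_le_mult_iff)
qed

text \<open>Positive dimension provides a unit vector, so the supremum is over a nonempty set and is
  at most any upper bound.\<close>

lemma induced_norm_le:
  assumes M: "M \<in> carrier_mat n n" and n: "n \<ge> 1"
    and le: "\<And>x. x \<in> carrier_vec n \<Longrightarrow> N (M *\<^sub>v x) \<le> B * N x"
  shows "induced_norm N M \<le> B"
  unfolding induced_norm_def
proof (rule cSup_least)
  have "unit_vec n 0 \<noteq> (0\<^sub>v n :: 'a Matrix.vec)"
    using n by (simp add: unit_vec_nonzero)
  then show "{N (M *\<^sub>v x) / N x |x. x \<in> carrier_vec (dim_col M) \<and> x \<noteq> 0\<^sub>v (dim_col M)} \<noteq> {}"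
    using M unit_vec_carrier[of n 0] by blast
qed (use M le pos in \<open>auto simp: divide_le_eq\<close>)

end

text \<open>Invertibility makes \<open>A\<close> a unit of the matrix ring, which rules out the
  result \<open>None\<close> of \<open>mat_inverse\<close>, so \<open>inverse_mat A\<close> is the
  true inverse.\<close>

lemma invertible_mat_inverse_mat:
  assumes A: "A \<in> carrier_mat n n" and inv: "invertible_mat A"
  shows "inverse_mat A \<in> carrier_mat n n" "A * inverse_mat A = 1\<^sub>m n" "inverse_mat A * A = 1\<^sub>m n"
proof -
  obtain B where B: "A * B = 1\<^sub>m n" "B * A = 1\<^sub>m (dim_row B)"
    using A inv unfolding invertible_mat_def inverts_mat_def by auto
  \<comment> \<open>\<open>invertible_mat\<close> does not fix the shape of \<open>B\<close>; it is
    read off from the shapes of the two products.\<close>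
  then have "dim_col B = n" "dim_row B = n"
    using A by (metis index_mult_mat(3) index_one_mat(3), metis carrier_matD(2) index_mult_mat(3) index_one_mat(3))
  then have "A \<in> Units (ring_mat TYPE('a) n ())"
    using A B unfolding Units_def ring_mat_def by auto
  then obtain C where "mat_inverse A = Some C"
    using mat_inverse(1)[OF A, where b = "()"] by (cases "mat_inverse A") auto
  with mat_inverse(2)[OF A this]
  show "inverse_mat A \<in> carrier_mat n n" "A * inverse_mat A = 1\<^sub>m n" "inverse_mat A * A = 1\<^sub>m n"
    by (auto simp: inverse_mat_def)
qed

section \<open>Error bound for an approximate inverse\<close>

context vector_norm_heine_borel
begin

text \<open>The factorisation of \<open>V\<close> through the inverse of \<open>A\<close> is tested
  on vectors: with \<open>z\<close> the solution of \<open>A z = y\<close>, one has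
  \<open>V y = z + E z\<close>.\<close>

lemma approximate_inverse_norm_le:
  assumes A: "A \<in> carrier_mat n n" "invertible_mat A" and V: "V \<in> carrier_mat n n" and n: "n \<ge> 1"
  shows "induced_norm N V \<le> (1 + induced_norm N (V * A - 1\<^sub>m n)) * induced_norm N (inverse_mat A)"
proof (rule induced_norm_le[OF V n])
  note I = invertible_mat_inverse_mat[OF A]
  define E where "E = V * A - 1\<^sub>m n"
  have E: "E \<in> carrier_mat n n" using A V by (simp add: E_def minus_carrier_mat)
  fix y :: "'a Matrix.vec" assume y: "y \<in> carrier_vec n"
  define z where "z = inverse_mat A *\<^sub>v y"
  have z: "z \<in> carrier_vec n" using I y by (simp add: z_def)
  have "A *\<^sub>v z = y"
    unfolding z_def using A I y by (simp flip: assoc_mult_mat_vec)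
  then have "E *\<^sub>v z = V *\<^sub>v y - z"
    using A V z by (simp add: E_def minus_mult_distrib_mat_vec[of _ n n])
  then have "V *\<^sub>v y = z + E *\<^sub>v z"
    using V y z by auto
  then have "N (V *\<^sub>v y) \<le> N z + N (E *\<^sub>v z)"
    using triangle z E by simp
  also have "\<dots> \<le> (1 + induced_norm N E) * N z"
    using mult_mat_vec_le[OF E z] by (simp add: algebra_simps)
  also have "\<dots> \<le> (1 + induced_norm N E) * (induced_norm N (inverse_mat A) * N y)"
    unfolding z_def using I y induced_norm_nonneg[OF E n] by (intro mult_left_mono mult_mat_vec_le) auto
  finally show "N (V *\<^sub>v y) \<le> (1 + induced_norm N (V * A - 1\<^sub>m n)) * induced_norm N (inverse_mat A) * N y"
    by (simp add: E_def mult.assoc)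
qed

lemma approximate_inverse_relative_error:
  assumes n: "n \<ge> 1" and eps: "\<epsilon> > 0" and pos_const: "C\<^sub>0 > 0" "C\<^sub>1 > 0" "C\<^sub>2 > 0"
    and A: "A \<in> carrier_mat n n" "invertible_mat A" and kappa: "cond_number N A * \<epsilon> \<le> C\<^sub>0"
    and b: "b \<in> carrier_vec n" "b \<noteq> 0\<^sub>v n" and x: "x = inverse_mat A *\<^sub>v b"
    and V: "V \<in> carrier_mat n n"
    and VA: "induced_norm N (V * A - 1\<^sub>m n) \<le> C\<^sub>1 * cond_number N A * \<epsilon>"
    and fl: "fl_mult_mat_vec N C\<^sub>2 \<epsilon> V b x\<^sub>V"
  shows "N (x\<^sub>V - x) / N x \<le> (C\<^sub>1 + C\<^sub>2 * (1 + C\<^sub>1 * C\<^sub>0)) * cond_number N A * \<epsilon>"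
proof -
  note I = invertible_mat_inverse_mat[OF A]
  define E where "E = V * A - 1\<^sub>m n"
  have E: "E \<in> carrier_mat n n" using A V by (simp add: E_def minus_carrier_mat)
  obtain \<Delta> where \<Delta>: "\<Delta> \<in> carrier_mat n n"
    "induced_norm N \<Delta> \<le> C\<^sub>2 * \<epsilon> * induced_norm N V" "x\<^sub>V = (V + \<Delta>) *\<^sub>v b"
    using fl V unfolding fl_mult_mat_vec_def by auto
  have xc: "x \<in> carrier_vec n" using I b by (simp add: x)
  have Ax: "A *\<^sub>v x = b"
    unfolding x using A I b by (simp flip: assoc_mult_mat_vec)
  then have "x \<noteq> 0\<^sub>v n" using A b by auto
  then have Nx: "0 < N x" by (simp add: pos xc)
  have "E *\<^sub>v x = V *\<^sub>v b - x"
    using A V xc Ax by (simp add: E_def minus_mult_distrib_mat_vec[of _ n n])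
  moreover have "x\<^sub>V = V *\<^sub>v b + \<Delta> *\<^sub>v b"
    using \<Delta>(1,3) V b by (simp add: add_mult_distrib_mat_vec[of _ n n])
  \<comment> \<open>The error splits into the defect of \<open>V\<close> as an inverse and the
    rounding error of the product.\<close>
  ultimately have "x\<^sub>V - x = E *\<^sub>v x + \<Delta> *\<^sub>v b"
    using V \<Delta>(1) b xc by auto
  then have err: "N (x\<^sub>V - x) \<le> N (E *\<^sub>v x) + N (\<Delta> *\<^sub>v b)"
    using triangle E \<Delta>(1) xc b by simp
  have Ex: "N (E *\<^sub>v x) \<le> C\<^sub>1 * cond_number N A * \<epsilon> * N x"
    using VA Nx unfolding E_def[symmetric]
    by (intro order_trans[OF mult_mat_vec_le[OF E xc]] mult_right_mono) auto
  \<comment> \<open>The bound \<open>C\<^sub>0\<close> on the condition number times \<epsilon>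
    enters here: it makes the factor in front of the norm of the inverse a constant.\<close>
  have "induced_norm N E \<le> C\<^sub>1 * C\<^sub>0"
    using order_trans[OF VA] mult_left_mono[OF kappa, of C\<^sub>1] pos_const
    by (simp add: E_def mult.assoc)
  then have "induced_norm N V \<le> (1 + C\<^sub>1 * C\<^sub>0) * induced_norm N (inverse_mat A)"
    using induced_norm_nonneg[OF I(1) n]
    by (intro order_trans[OF approximate_inverse_norm_le[OF A V n]] mult_right_mono)
      (auto simp flip: E_def)
  then have "C\<^sub>2 * \<epsilon> * induced_norm N V \<le> C\<^sub>2 * \<epsilon> * ((1 + C\<^sub>1 * C\<^sub>0) * induced_norm N (inverse_mat A))"
    using pos_const eps by (intro mult_left_mono) auto
  then have Delta_le: "induced_norm N \<Delta> \<le> C\<^sub>2 * \<epsilon> * ((1 + C\<^sub>1 * C\<^sub>0) * induced_norm N (inverse_mat A))"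
    using \<Delta>(2) by linarith
  have "N (\<Delta> *\<^sub>v b) \<le> induced_norm N \<Delta> * N b"
    using mult_mat_vec_le[OF \<Delta>(1) b(1)] .
  \<comment> \<open>Writing \<open>b\<close> as \<open>A x\<close> brings in the norm of
    \<open>A\<close>, which pairs with the norm of the inverse to form the condition number.\<close>
  also have "\<dots> \<le> induced_norm N \<Delta> * (induced_norm N A * N x)"
    using mult_mat_vec_le[OF A(1) xc] induced_norm_nonneg[OF \<Delta>(1) n] Ax
    by (intro mult_left_mono) auto
  also have "\<dots> \<le> C\<^sub>2 * \<epsilon> * ((1 + C\<^sub>1 * C\<^sub>0) * induced_norm N (inverse_mat A)) * (induced_norm N A * N x)"
    using induced_norm_nonneg[OF A(1) n] Nx by (intro mult_right_mono Delta_le) auto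
  also have "\<dots> = C\<^sub>2 * (1 + C\<^sub>1 * C\<^sub>0) * cond_number N A * \<epsilon> * N x"
    by (simp add: cond_number_def)
  finally have "N (x\<^sub>V - x) \<le> (C\<^sub>1 + C\<^sub>2 * (1 + C\<^sub>1 * C\<^sub>0)) * cond_number N A * \<epsilon> * N x"
    using err Ex by (simp add: algebra_simps)
  then show ?thesis using Nx by (simp add: divide_le_eq)
qed

end

theorem theorem1:
  fixes C\<^sub>0 C\<^sub>1 C\<^sub>2 :: real
  assumes "C\<^sub>0 > 0" and "C\<^sub>1 > 0" and "C\<^sub>2 > 0"
  shows "\<exists>C::real. C > 0 \<and>
    (\<forall>n::nat. \<forall>N :: real Matrix.vec \<Rightarrow> real. \<forall>\<epsilon>::real. \<forall>A V :: real Matrix.mat. \<forall>b x x\<^sub>V :: real Matrix.vec.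
       n \<ge> 1 \<longrightarrow> is_vector_norm n N \<longrightarrow> \<epsilon> > 0 \<longrightarrow>
       A \<in> carrier_mat n n \<longrightarrow> invertible_mat A \<longrightarrow> cond_number N A * \<epsilon> \<le> C\<^sub>0 \<longrightarrow>
       b \<in> carrier_vec n \<longrightarrow> b \<noteq> 0\<^sub>v n \<longrightarrow> x = inverse_mat A *\<^sub>v b \<longrightarrow>
       V \<in> carrier_mat n n \<longrightarrow>
       induced_norm N (V * A - 1\<^sub>m n) \<le> C\<^sub>1 * cond_number N A * \<epsilon> \<longrightarrow>
       fl_mult_mat_vec N C\<^sub>2 \<epsilon> V b x\<^sub>V \<longrightarrow>
       N (x\<^sub>V - x) / N x \<le> C * cond_number N A * \<epsilon>) \<and>
    (\<forall>n::nat. \<forall>N :: complex Matrix.vec \<Rightarrow> real. \<forall>\<epsilon>::real. \<forall>A V :: complex Matrix.mat. \<forall>b x x\<^sub>V :: complex Matrix.vec.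
       n \<ge> 1 \<longrightarrow> is_vector_norm n N \<longrightarrow> \<epsilon> > 0 \<longrightarrow>
       A \<in> carrier_mat n n \<longrightarrow> invertible_mat A \<longrightarrow> cond_number N A * \<epsilon> \<le> C\<^sub>0 \<longrightarrow>
       b \<in> carrier_vec n \<longrightarrow> b \<noteq> 0\<^sub>v n \<longrightarrow> x = inverse_mat A *\<^sub>v b \<longrightarrow>
       V \<in> carrier_mat n n \<longrightarrow>
       induced_norm N (V * A - 1\<^sub>m n) \<le> C\<^sub>1 * cond_number N A * \<epsilon> \<longrightarrow>
       fl_mult_mat_vec N C\<^sub>2 \<epsilon> V b x\<^sub>V \<longrightarrow>
       N (x\<^sub>V - x) / N x \<le> C * cond_number N A * \<epsilon>)"
proof (intro exI conjI allI impI)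
  \<comment> \<open>The witness mentions neither the dimension, the norm nor the scalar field, so
    one constant settles the real and the complex case.\<close>
  show "0 < C\<^sub>1 + C\<^sub>2 * (1 + C\<^sub>1 * C\<^sub>0)"
    using assms by (simp add: add_pos_pos)
qed (rule vector_norm_heine_borel.approximate_inverse_relative_error;
  simp add: assms vector_norm_heine_borel_def vector_norm_def)+

end
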